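(* Let $\Gamma$ be a numerical semigroup with multiplicity $m$ and concentration $\mathbf{C}(\Gamma)=k$. If $\delta(\Gamma)\geq m-k$, then $W_\Gamma(k+1)\geq 0$. In particular, $k+1\geq\mu_\Gamma$.
   Context: $\mathbb{N}$ denotes the set of nonnegative integers. A numerical semigroup $\Gamma$ is an additive submonoid of $(\mathbb{N},+)$ whose elements have greatest common divisor $1$, so that $\mathbb{N}\setminus\Gamma$ is finite; it is assumed that $\Gamma\neq\mathbb{N}$. The multiplicity is $m=m(\Gamma)=\min(\Gamma\setminus\{0\})$, the conductor is $c=c(\Gamma)=\max(\mathbb{N}\setminus\Gamma)+1$, and the delta-invariant $\delta(\Gamma)$ is the number of elements of $\Gamma$ (including $0$) that are smaller than $c$. The concentration of $\Gamma$ is $\mathbf{C}(\Gamma)=\max\{\operatorname{next}_\Gamma(s)-s : s\in\Gamma\setminus\{0\}\}$, where $\operatorname{next}_\Gamma(s)=\min\{x\in\Gamma : s<x\}$. The Wilf function is $W_\Gamma:\mathbb{N}\to\mathbb{Z}$, $W_\Gamma(k)=k\,\delta(\Gamma)-c(\Gamma)$, and $\mu_\Gamma=\min\{k\in\mathbb{N} : W_\Gamma(k)\geq 0\}$. *)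

theory Defs
  imports Main
begin

definition numerical_semigroup :: "nat set \<Rightarrow> bool" where
  "numerical_semigroup \<Gamma> \<longleftrightarrow>
     0 \<in> \<Gamma> \<and> (\<forall>x\<in>\<Gamma>. \<forall>y\<in>\<Gamma>. x + y \<in> \<Gamma>) \<and> Gcd \<Gamma> = 1"

definition multiplicity :: "nat set \<Rightarrow> nat" where
  "multiplicity \<Gamma> = (LEAST x. x \<in> \<Gamma> - {0})"

(* Max requires the set of gaps to be finite (guaranteed by Gcd \<Gamma> = 1) and
   nonempty (\<Gamma> \<noteq> UNIV). *)
definition conductor :: "nat set \<Rightarrow> nat" where
  "conductor \<Gamma> = Max (UNIV - \<Gamma>) + 1"

definition delta :: "nat set \<Rightarrow> nat" where
  "delta \<Gamma> = card {x \<in> \<Gamma>. x < conductor \<Gamma>}"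

definition next_elem :: "nat set \<Rightarrow> nat \<Rightarrow> nat" where
  "next_elem \<Gamma> s = (LEAST x. x \<in> \<Gamma> \<and> s < x)"

(* The set of differences is finite for a numerical semigroup, since
   next_elem \<Gamma> s - s = 1 for all s \<ge> conductor \<Gamma>.  The natural-number
   subtraction does not truncate because s < next_elem \<Gamma> s. *)
definition concentration :: "nat set \<Rightarrow> nat" where
  "concentration \<Gamma> = Max {next_elem \<Gamma> s - s | s. s \<in> \<Gamma> - {0}}"

definition wilf :: "nat set \<Rightarrow> nat \<Rightarrow> int" where
  "wilf \<Gamma> k = int k * int (delta \<Gamma>) - int (conductor \<Gamma>)"

definition wilf_mu :: "nat set \<Rightarrow> nat" where
  "wilf_mu \<Gamma> = (LEAST k. wilf \<Gamma> k \<ge> 0)"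

end

theory Submission
  imports Defs
begin

text \<open>
  By definition of the concentration \<open>k\<close>, every integer \<open>n \<ge> m\<close> lies at distance less than \<open>k\<close>
  above some nonzero semigroup element, namely the largest one not exceeding \<open>n\<close>. Hence the
  blocks \<open>{s..<s + k}\<close>, where \<open>s\<close> runs through the \<open>\<delta> - 1\<close> nonzero elements below the conductor
  \<open>c\<close>, cover \<open>{m..<c}\<close>, which gives \<open>c \<le> m + k (\<delta> - 1)\<close> (lemma
  \<open>conductor_le_multiplicity_concentration\<close>). With \<open>m \<le> \<delta> + k\<close> this becomes \<open>c \<le> (k + 1) \<delta>\<close>.

  The concentration is a maximum of finitely many gaps only because \<open>\<Gamma>\<close> contains all large
  integers. This follows from the gcd condition by a Euclidean argument on differences: the least
  positive difference between two elements divides every element, hence is \<open>1\<close>, and two consecutive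
  elements \<open>a\<close>, \<open>a + 1\<close> generate everything from \<open>a\<^sup>2\<close> on (lemma \<open>cofinite_tail\<close>).
\<close>

lemma mult_mem:
  assumes "numerical_semigroup \<Gamma>" "x \<in> \<Gamma>"
  shows "q * x \<in> \<Gamma>"
  using assms by (induction q) (auto simp: numerical_semigroup_def)

lemma add_mem:
  assumes "numerical_semigroup \<Gamma>" "x \<in> \<Gamma>" "y \<in> \<Gamma>"
  shows "x + y \<in> \<Gamma>"
  using assms by (auto simp: numerical_semigroup_def)

lemma nonzero_element_exists:
  assumes "numerical_semigroup \<Gamma>"
  obtains x where "x \<in> \<Gamma>" "x > 0"
proof -
  have "\<not> \<Gamma> \<subseteq> {0}"
    using assms Gcd_0_iff[of \<Gamma>] by (auto simp: numerical_semigroup_def)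
  thus thesis
    using that by auto
qed

text \<open>
  If \<open>a\<close> and \<open>a + d\<close> realise the least positive difference and \<open>x = q d + r\<close> with \<open>0 < r < d\<close>, then
  \<open>x + q a\<close> and \<open>q (a + d)\<close> are elements whose difference is the smaller number \<open>r\<close>.
\<close>
lemma consecutive_elements:
  assumes S: "numerical_semigroup \<Gamma>"
  obtains a where "a \<in> \<Gamma>" "a + 1 \<in> \<Gamma>"
proof -
  define D where "D d \<longleftrightarrow> d > 0 \<and> (\<exists>a. a \<in> \<Gamma> \<and> a + d \<in> \<Gamma>)" for d
  obtain x where "x \<in> \<Gamma>" "x > 0"
    using nonzero_element_exists[OF S] .
  hence "D x"
    using S by (auto simp: D_def numerical_semigroup_def intro: exI[of _ 0])
  define d where "d = (LEAST d. D d)"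
  have "D d"
    unfolding d_def by (rule LeastI) fact
  then obtain a where a: "d > 0" "a \<in> \<Gamma>" "a + d \<in> \<Gamma>"
    by (auto simp: D_def)
  have "d dvd x" if "x \<in> \<Gamma>" for x
  proof (rule ccontr)
    assume "\<not> d dvd x"
    hence r: "x mod d > 0"
      by (simp add: mod_greater_zero_iff_not_dvd)
    have "x + (x div d) * a \<in> \<Gamma>" "(x div d) * (a + d) \<in> \<Gamma>"
      using S a that by (auto intro: add_mem mult_mem)
    moreover have "x + (x div d) * a = (x div d) * (a + d) + x mod d"
      using div_mult_mod_eq[of x d] by (simp add: algebra_simps)
    ultimately have "D (x mod d)"
      using r unfolding D_def by metis
    hence "d \<le> x mod d"
      unfolding d_def by (rule Least_le)
    thus False
      using a(1) mod_less_divisor[of d x] by linarith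
  qed
  hence "d dvd Gcd \<Gamma>"
    by (rule Gcd_greatest)
  hence "d = 1"
    using S by (simp add: numerical_semigroup_def)
  thus thesis
    using a that by blast
qed

text \<open>
  Writing \<open>n = q a + r\<close> with \<open>r < a \<le> q\<close> gives the representation \<open>n = (q - r) a + r (a + 1)\<close>.
\<close>
lemma cofinite_tail:
  assumes S: "numerical_semigroup \<Gamma>"
  obtains N where "\<And>n. n \<ge> N \<Longrightarrow> n \<in> \<Gamma>"
proof -
  obtain a where a: "a \<in> \<Gamma>" "a + 1 \<in> \<Gamma>"
    using consecutive_elements[OF S] .
  have "n \<in> \<Gamma>" if n: "n \<ge> a * a" for n
  proof (cases "a = 0")
    case True
    thus ?thesis
      using mult_mem[OF S a(2), of n] by simp
  next
    case False
    define q r where "q = n div a" and "r = n mod a"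
    have "r < a" "a \<le> q"
      using False n by (auto simp: q_def r_def less_eq_div_iff_mult_less_eq)
    then obtain p where p: "q = p + r"
      by (metis add.commute le_iff_add less_imp_le order_trans)
    have "n = q * a + r"
      by (simp add: q_def r_def)
    hence "n = p * a + r * (a + 1)"
      by (simp add: p algebra_simps)
    thus ?thesis
      using add_mem[OF S mult_mem[OF S a(1)] mult_mem[OF S a(2)]] by simp
  qed
  thus thesis
    using that by blast
qed

lemma next_elem_props:
  assumes S: "numerical_semigroup \<Gamma>"
  shows "next_elem \<Gamma> s \<in> \<Gamma>" "s < next_elem \<Gamma> s"
proof -
  obtain N where N: "\<And>n. n \<ge> N \<Longrightarrow> n \<in> \<Gamma>"
    using cofinite_tail[OF S] by blast
  have "s + N + 1 \<in> \<Gamma> \<and> s < s + N + 1"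
    using N by simp
  hence "next_elem \<Gamma> s \<in> \<Gamma> \<and> s < next_elem \<Gamma> s"
    unfolding next_elem_def by (rule LeastI)
  thus "next_elem \<Gamma> s \<in> \<Gamma>" "s < next_elem \<Gamma> s"
    by auto
qed

lemma next_elem_le_add_concentration:
  assumes S: "numerical_semigroup \<Gamma>" and s: "s \<in> \<Gamma>" "s > 0"
  shows "next_elem \<Gamma> s \<le> s + concentration \<Gamma>"
proof -
  obtain N where N: "\<And>n. n \<ge> N \<Longrightarrow> n \<in> \<Gamma>"
    using cofinite_tail[OF S] by blast
  let ?D = "{next_elem \<Gamma> s - s | s. s \<in> \<Gamma> - {0}}"
  \<comment> \<open>\<open>t + N + 1\<close> is always an element beyond \<open>t\<close>, so the differences are uniformly bounded.\<close>
  have "next_elem \<Gamma> t \<le> t + N + 1" for t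
    unfolding next_elem_def by (rule Least_le) (simp add: N)
  hence "?D \<subseteq> {..N + 1}"
    by (auto simp: le_diff_conv add_ac)
  hence "finite ?D"
    using finite_subset by blast
  hence "next_elem \<Gamma> s - s \<le> concentration \<Gamma>"
    unfolding concentration_def using s by (intro Max_ge) auto
  thus ?thesis
    by linarith
qed

lemma multiplicity_props:
  assumes "numerical_semigroup \<Gamma>"
  shows "multiplicity \<Gamma> \<in> \<Gamma>" "multiplicity \<Gamma> > 0"
    and "\<And>x. x \<in> \<Gamma> \<Longrightarrow> x > 0 \<Longrightarrow> multiplicity \<Gamma> \<le> x"
proof -
  obtain x where "x \<in> \<Gamma>" "x > 0"
    using nonzero_element_exists[OF assms] .
  hence "x \<in> \<Gamma> - {0}"
    by simp
  hence "multiplicity \<Gamma> \<in> \<Gamma> - {0}"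
    unfolding multiplicity_def by (rule LeastI)
  thus "multiplicity \<Gamma> \<in> \<Gamma>" "multiplicity \<Gamma> > 0"
    by auto
  show "multiplicity \<Gamma> \<le> y" if "y \<in> \<Gamma>" "y > 0" for y
    unfolding multiplicity_def using that by (intro Least_le) auto
qed

text \<open>
  The element sought is the largest one not exceeding \<open>n\<close>: its successor in \<open>\<Gamma>\<close> lies beyond \<open>n\<close>,
  but at most one concentration away.
\<close>
lemma element_within_concentration:
  assumes S: "numerical_semigroup \<Gamma>" and n: "multiplicity \<Gamma> \<le> n"
  obtains s where "s \<in> \<Gamma>" "multiplicity \<Gamma> \<le> s" "s \<le> n" "n < s + concentration \<Gamma>"
proof -
  let ?A = "{x \<in> \<Gamma>. x \<le> n}"
  define s where "s = Max ?A"
  have fin: "finite ?A"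
    by (rule finite_subset[of _ "{..n}"]) auto
  have m: "multiplicity \<Gamma> \<in> ?A"
    using multiplicity_props(1)[OF S] n by simp
  have "s \<in> ?A"
    unfolding s_def using fin m by (intro Max_in) auto
  moreover have ms: "multiplicity \<Gamma> \<le> s"
    unfolding s_def using fin m by (rule Max_ge)
  moreover have "n < s + concentration \<Gamma>"
  proof -
    have "n < next_elem \<Gamma> s"
    proof (rule ccontr)
      assume "\<not> n < next_elem \<Gamma> s"
      hence "next_elem \<Gamma> s \<in> ?A"
        using next_elem_props(1)[OF S] by simp
      hence "next_elem \<Gamma> s \<le> s"
        unfolding s_def using fin by (intro Max_ge)
      thus False
        using next_elem_props(2)[OF S, of s] by simp
    qed
    also have "\<dots> \<le> s + concentration \<Gamma>"
      using \<open>s \<in> ?A\<close> ms multiplicity_props(2)[OF S]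
      by (intro next_elem_le_add_concentration[OF S]) auto
    finally show ?thesis .
  qed
  ultimately show thesis
    using that by auto
qed

lemma delta_eq_Suc_card_nonzero:
  assumes S: "numerical_semigroup \<Gamma>"
  shows "delta \<Gamma> = Suc (card {s \<in> \<Gamma>. multiplicity \<Gamma> \<le> s \<and> s < conductor \<Gamma>})"
    (is "_ = Suc (card ?B)")
proof -
  have "{x \<in> \<Gamma>. x < conductor \<Gamma>} = insert 0 ?B"
    using S multiplicity_props(3)[OF S]
    by (auto simp: numerical_semigroup_def conductor_def)
  moreover have "0 \<notin> ?B"
    using multiplicity_props(2)[OF S] by auto
  moreover have "finite ?B"
    by (rule finite_subset[of _ "{..<conductor \<Gamma>}"]) auto
  ultimately show ?thesis
    by (simp add: delta_def)
qed

text \<open>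
  Counting the cover of \<open>{m..<c}\<close> by the \<open>\<delta> - 1\<close> blocks of length \<open>\<^bold>C(\<Gamma>)\<close> that start at the
  nonzero elements below \<open>c\<close>.
\<close>
lemma conductor_le_multiplicity_concentration:
  assumes S: "numerical_semigroup \<Gamma>"
  shows "conductor \<Gamma> \<le> multiplicity \<Gamma> + concentration \<Gamma> * (delta \<Gamma> - 1)"
proof -
  let ?B = "{s \<in> \<Gamma>. multiplicity \<Gamma> \<le> s \<and> s < conductor \<Gamma>}"
  let ?U = "\<Union>s\<in>?B. {s..<s + concentration \<Gamma>}"
  have fin: "finite ?B"
    by (rule finite_subset[of _ "{..<conductor \<Gamma>}"]) auto
  have "{multiplicity \<Gamma>..<conductor \<Gamma>} \<subseteq> ?U"
  proof
    fix n assume n: "n \<in> {multiplicity \<Gamma>..<conductor \<Gamma>}"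
    then obtain s where "s \<in> \<Gamma>" "multiplicity \<Gamma> \<le> s" "s \<le> n" "n < s + concentration \<Gamma>"
      using element_within_concentration[OF S, of n] by auto
    thus "n \<in> ?U"
      using n by force
  qed
  hence "card {multiplicity \<Gamma>..<conductor \<Gamma>} \<le> card ?U"
    using fin by (intro card_mono) auto
  also have "\<dots> \<le> (\<Sum>s\<in>?B. card {s..<s + concentration \<Gamma>})"
    using fin by (rule card_UN_le)
  also have "\<dots> = concentration \<Gamma> * (delta \<Gamma> - 1)"
    by (simp add: delta_eq_Suc_card_nonzero[OF S])
  finally show ?thesis
    by simp
qed

theorem proposition3p6:
  fixes \<Gamma> :: "nat set" and m k :: nat
  assumes "numerical_semigroup \<Gamma>" and "\<Gamma> \<noteq> UNIV"
    and "multiplicity \<Gamma> = m"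
    and "concentration \<Gamma> = k"
    and "int (delta \<Gamma>) \<ge> int m - int k"
  shows "wilf \<Gamma> (k + 1) \<ge> 0 \<and> k + 1 \<ge> wilf_mu \<Gamma>"
proof -
  obtain d where d: "delta \<Gamma> = Suc d"
    using delta_eq_Suc_card_nonzero[OF assms(1)] by blast
  have "conductor \<Gamma> \<le> m + k * d"
    using conductor_le_multiplicity_concentration[OF assms(1)] assms(3,4) d by simp
  also have "m \<le> Suc d + k"
    using assms(5) d by linarith
  hence "m + k * d \<le> (k + 1) * delta \<Gamma>"
    by (simp add: d algebra_simps)
  finally have "int (conductor \<Gamma>) \<le> int ((k + 1) * delta \<Gamma>)"
    by (rule zle_int[THEN iffD2])
  hence W: "wilf \<Gamma> (k + 1) \<ge> 0"
    unfolding wilf_def of_nat_mult by linarith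
  moreover have "wilf_mu \<Gamma> \<le> k + 1"
    unfolding wilf_mu_def using W by (rule Least_le)
  ultimately show ?thesis
    by simp
qed

end
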